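(* Let $1<q<p<\infty$, $\alpha\in\mathbb{R}$, let $v,w$ be weight functions on $\mathbb{R}^2$, and let $\phi\in L^1(\mathbb{R}^2)$ be such that $$\mathscr{D}_{\sup}:=\int_{\mathbb{R}^2} \frac{|\phi(t_1,t_2)|}{|t_1t_2|^{2\alpha+2-\frac1q}}\left(\int_{\mathbb{R}^2}\frac{[v(t_1y_1,t_2y_2)]^{\frac{p}{p-q}}}{[w(y_1,y_2)]^{\frac{q}{p-q}}}\,dy_1dy_2\right)^{\frac{p-q}{pq}}dt_1dt_2<\infty .$$ Then the operator $\mathscr{H}_{\alpha,\phi}:L^p_w(\mathbb{R}^2)\to L^q_v(\mathbb{R}^2)$ is bounded and, for every $f\in L^p_w(\mathbb{R}^2)$, $$\|\mathscr{H}_{\alpha,\phi}f\|_{L^q_v(\mathbb{R}^2)}\le \mathscr{D}_{\sup}\,\|f\|_{L^p_w(\mathbb{R}^2)}.$$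
   Context: A weight function on $\mathbb{R}^2$ is a measurable function $v:\mathbb{R}^2\to[0,\infty]$ that is positive and finite almost everywhere. For $1\le r<\infty$, $L^r_v(\mathbb{R}^2)$ is the weighted Lebesgue space with norm $\|f\|_{L^r_v(\mathbb{R}^2)}=\left(\int_{\mathbb{R}^2}|f(x_1,x_2)|^r v(x_1,x_2)\,dx_1dx_2\right)^{1/r}$. The two dimensional Dunkl-Hausdorff operator is $$\mathscr{H}_{\alpha,\phi}f(x_1,x_2)=\int_{\mathbb{R}^2}\frac{|\phi(t_1,t_2)|}{|t_1t_2|^{2\alpha+2}}f\left(\frac{x_1}{t_1},\frac{x_2}{t_2}\right)dt_1dt_2 .$$ It is bounded from $L^p_w(\mathbb{R}^2)$ to $L^q_v(\mathbb{R}^2)$ if for every $f\in L^p_w(\mathbb{R}^2)$ the integral converges absolutely for a.e. $(x_1,x_2)$ and there is a finite constant $C$ with $\|\mathscr{H}_{\alpha,\phi}f\|_{L^q_v(\mathbb{R}^2)}\le C\|f\|_{L^p_w(\mathbb{R}^2)}$ for all such $f$. Convention: $0\cdot\infty=0$. *)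

theory Defs
  imports "HOL-Analysis.Analysis"
begin

text \<open>
  The plane is \<^typ>\<open>real \<times> real\<close> with the completed Lebesgue measure \<^term>\<open>lebesgue\<close>, so
  "measurable" and "almost everywhere" are meant in the sense of Lebesgue. Elements of the
  function spaces are represented by complex-valued functions; no quotient by equality
  almost everywhere is taken.
\<close>

text \<open>
  Powers in the extended half-line. Only positive exponents are used, for which infinity is
  sent to infinity and 0 to 0.
\<close>
definition ennreal_powr :: "ennreal \<Rightarrow> real \<Rightarrow> ennreal" where
  "ennreal_powr x r = (if x = \<infinity> then \<infinity> else ennreal (enn2real x powr r))"

definition weight_function :: "(real \<times> real \<Rightarrow> ennreal) \<Rightarrow> bool" where
  "weight_function v \<longleftrightarrow>
     v \<in> borel_measurable lebesgue \<and> (AE x in lebesgue. 0 < v x \<and> v x < \<infinity>)"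

text \<open>
  The weighted norm takes the value infinity outside the weighted space. Multiplication on
  \<^typ>\<open>ennreal\<close> satisfies the convention that zero times infinity is zero.
\<close>
definition weighted_norm ::
    "real \<Rightarrow> (real \<times> real \<Rightarrow> ennreal) \<Rightarrow> (real \<times> real \<Rightarrow> complex) \<Rightarrow> ennreal" where
  "weighted_norm r v f =
     ennreal_powr (\<integral>\<^sup>+ x. ennreal (norm (f x) powr r) * v x \<partial>lebesgue) (1 / r)"

definition weighted_Lebesgue ::
    "real \<Rightarrow> (real \<times> real \<Rightarrow> ennreal) \<Rightarrow> (real \<times> real \<Rightarrow> complex) set" where
  "weighted_Lebesgue r v = {f \<in> borel_measurable lebesgue. weighted_norm r v f < \<infinity>}"

text \<open>
  In the integrands below, the values at points with a zero coordinate of \<open>t\<close> (where Isabelle's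
  conventions for division by zero apply) are irrelevant, as these points form a null set.
\<close>
definition dunkl_hausdorff_integrand ::
    "real \<Rightarrow> (real \<times> real \<Rightarrow> complex) \<Rightarrow> (real \<times> real \<Rightarrow> complex) \<Rightarrow>
     real \<times> real \<Rightarrow> real \<times> real \<Rightarrow> complex" where
  "dunkl_hausdorff_integrand \<alpha> \<phi> f = (\<lambda>(x1, x2) (t1, t2).
     complex_of_real (norm (\<phi> (t1, t2)) / \<bar>t1 * t2\<bar> powr (2 * \<alpha> + 2)) * f (x1 / t1, x2 / t2))"

definition dunkl_hausdorff ::
    "real \<Rightarrow> (real \<times> real \<Rightarrow> complex) \<Rightarrow> (real \<times> real \<Rightarrow> complex) \<Rightarrow> real \<times> real \<Rightarrow> complex" where
  "dunkl_hausdorff \<alpha> \<phi> f x = (LINT t|lebesgue. dunkl_hausdorff_integrand \<alpha> \<phi> f x t)"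

text \<open>
  Absolute convergence is Bochner integrability. Membership of the image in the target space
  is stated separately because the norm inequality does not include measurability.
\<close>
definition dunkl_hausdorff_bounded ::
    "real \<Rightarrow> (real \<times> real \<Rightarrow> complex) \<Rightarrow> real \<Rightarrow> (real \<times> real \<Rightarrow> ennreal) \<Rightarrow>
     real \<Rightarrow> (real \<times> real \<Rightarrow> ennreal) \<Rightarrow> bool" where
  "dunkl_hausdorff_bounded \<alpha> \<phi> p w q v \<longleftrightarrow>
     (\<forall>f \<in> weighted_Lebesgue p w.
        (AE x in lebesgue. integrable lebesgue (dunkl_hausdorff_integrand \<alpha> \<phi> f x)) \<and>
        dunkl_hausdorff \<alpha> \<phi> f \<in> weighted_Lebesgue q v) \<and>
     (\<exists>C < \<infinity>. \<forall>f \<in> weighted_Lebesgue p w.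
        weighted_norm q v (dunkl_hausdorff \<alpha> \<phi> f) \<le> C * weighted_norm p w f)"

definition D_sup ::
    "real \<Rightarrow> real \<Rightarrow> real \<Rightarrow> (real \<times> real \<Rightarrow> ennreal) \<Rightarrow> (real \<times> real \<Rightarrow> ennreal) \<Rightarrow>
     (real \<times> real \<Rightarrow> complex) \<Rightarrow> ennreal" where
  "D_sup \<alpha> p q v w \<phi> =
     (\<integral>\<^sup>+ (t1, t2).
        ennreal (norm (\<phi> (t1, t2)) / \<bar>t1 * t2\<bar> powr (2 * \<alpha> + 2 - 1 / q)) *
        ennreal_powr
          (\<integral>\<^sup>+ (y1, y2). ennreal_powr (v (t1 * y1, t2 * y2)) (p / (p - q)) /
                          ennreal_powr (w (y1, y2)) (q / (p - q)) \<partial>lebesgue)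
          ((p - q) / (p * q))
      \<partial>lebesgue)"

end

theory Submission
  imports Defs
begin

text \<open>
  The operator is a superposition over \<open>t\<close> of the dilations \<open>f \<mapsto> f (x / t)\<close> (coordinatewise
  quotient), with the nonnegative weight \<open>k t = |\<phi> t| / |t1 t2|^(2 \<alpha> + 2)\<close>. Minkowski's integral
  inequality (\<open>Minkowski_nn_integral\<close>) bounds the norm of a superposition by the superposition of
  the norms, so everything reduces to the norm of one dilation as a map from the
  space with exponent \<open>p\<close> and weight \<open>w\<close> to the one with exponent \<open>q\<close> and weight \<open>v\<close>.

  For fixed \<open>t\<close> the substitution \<open>x = t y\<close> gives
  \<open>\<integral> |f (x / t)|^q v x dx = |t1 t2| \<integral> |f y|^q v (t y) dy\<close>. Writing the last integrand as
  \<open>(|f y|^p w y)^(q / p)\<close> times \<open>(v (t y)^(p / (p - q)) / w y^(q / (p - q)))^((p - q) / p)\<close>, Hoelder's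
  inequality with the exponents \<open>p / q\<close> and \<open>p / (p - q)\<close> separates the norm of \<open>f\<close> from the
  inner integral of the constant \<open>D_sup\<close> (\<open>nn_integral_dilation_le\<close>). After taking \<open>q\<close>-th roots, the
  Jacobian contributes \<open>|t1 t2|^(1 / q)\<close>, which is why the exponent in \<open>D_sup\<close> is
  \<open>2 \<alpha> + 2 - 1 / q\<close>, and integrating against \<open>k\<close> gives the estimate (\<open>Hausdorff_norm_le\<close>).

  All of this is done with extended nonnegative integrals, for the operator applied to
  \<open>|f|\<close>. Since \<open>v\<close> is positive almost everywhere, finiteness of the resulting norm forces
  the integral to be finite at almost every \<open>x\<close>, which is the absolute convergence.

  Tonelli's theorem needs integrands that are jointly measurable in \<open>x\<close> and \<open>t\<close>, which
  \<open>f (x / t)\<close> need not be for the product of two Lebesgue \<open>\<sigma>\<close>-algebras. Hence \<open>f\<close>, \<open>v\<close>, \<open>w\<close> and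
  \<open>\<phi>\<close> are first replaced by Borel functions equal to them almost everywhere. This changes no
  integral, because dilations preserve null sets, and because, again by Tonelli, for almost
  every \<open>x\<close> the point \<open>x / t\<close> avoids a given null set for almost every \<open>t\<close> (\<open>AE_AE_quotient\<close>).
\<close>

section \<open>Powers of extended nonnegative reals\<close>

lemma ennreal_powr_ennreal: "0 \<le> x \<Longrightarrow> ennreal_powr (ennreal x) r = ennreal (x powr r)"
  by (simp add: ennreal_powr_def)

lemma ennreal_powr_top [simp]: "ennreal_powr top r = top"
  by (simp add: ennreal_powr_def)

lemma ennreal_powr_zero [simp]: "ennreal_powr 0 r = 0"
  by (simp add: ennreal_powr_def)

lemma ennreal_powr_one_right [simp]: "ennreal_powr x 1 = x"
  by (cases x) (auto simp: ennreal_powr_def)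

lemma ennreal_powr_mono:
  assumes "x \<le> y" "0 \<le> r"
  shows "ennreal_powr x r \<le> ennreal_powr y r"
  using assms by (cases x; cases y) (auto simp: ennreal_powr_def powr_mono2 top_unique)

lemma ennreal_powr_mult:
  assumes "0 < r"
  shows "ennreal_powr (x * y) r = ennreal_powr x r * ennreal_powr y r"
  using assms
  by (cases x; cases y)
     (auto simp: ennreal_powr_def powr_mult ennreal_mult ennreal_mult_top ennreal_top_mult
       enn2real_mult ennreal_mult_eq_top_iff)

lemma ennreal_powr_powr:
  "ennreal_powr (ennreal_powr x r) s = ennreal_powr x (r * s)"
  by (cases x) (auto simp: ennreal_powr_def powr_powr)

lemma ennreal_powr_eq_0_iff [simp]: "ennreal_powr x r = 0 \<longleftrightarrow> x = 0"
  by (cases x) (auto simp: ennreal_powr_def enn2real_eq_0_iff)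

lemma ennreal_powr_less_top_iff [simp]: "ennreal_powr x r < top \<longleftrightarrow> x < top"
  by (cases x) (auto simp: ennreal_powr_def)

lemma ennreal_powr_add:
  assumes "0 < r" "0 < s"
  shows "ennreal_powr x r * ennreal_powr x s = ennreal_powr x (r + s)"
  using assms by (cases x) (auto simp: ennreal_powr_def powr_add ennreal_mult ennreal_mult_top)

lemma measurable_ennreal_powr [measurable]:
  assumes [measurable]: "f \<in> borel_measurable M"
  shows "(\<lambda>x. ennreal_powr (f x) r) \<in> borel_measurable M"
  unfolding ennreal_powr_def by measurable

section \<open>The inequalities of Hoelder and Minkowski\<close>

lemma weighted_AM_GM_ennreal:
  assumes "0 < \<theta>" "\<theta> < 1"
  shows "ennreal_powr x \<theta> * ennreal_powr y (1 - \<theta>) \<le> ennreal \<theta> * x + ennreal (1 - \<theta>) * y"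
proof (cases "x = 0 \<or> y = 0 \<or> x = \<infinity> \<or> y = \<infinity>")
  case True
  then show ?thesis
    using assms by (auto simp: ennreal_mult_top)
next
  case False
  then obtain a b where ab: "x = ennreal a" "y = ennreal b" "0 < a" "0 < b"
    by (cases x; cases y) (auto simp: less_le)
  have "a powr \<theta> * b powr (1 - \<theta>) \<le> \<theta> * a + (1 - \<theta>) * b"
    using Youngs_inequality_0 [of \<theta> "1 - \<theta>" a b] assms ab by simp
  then show ?thesis
    using ab assms
    by (simp add: ennreal_powr_ennreal ennreal_mult' [symmetric] ennreal_plus [symmetric] ennreal_leI del: ennreal_plus)
qed

text \<open>
  If both integrals are positive and finite, scaling \<open>f\<close> and \<open>g\<close> to integral 1 reduces the claim to
  the integrated weighted inequality between the arithmetic and geometric mean. This homogeneous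
  form, with exponents adding up to 1 inside the integral, also makes sense for infinite values,
  so that no finiteness has to be checked when it is applied.
\<close>

lemma Holder_nn_integral:
  assumes [measurable]: "f \<in> borel_measurable M" "g \<in> borel_measurable M"
    and \<theta>: "0 < \<theta>" "\<theta> < 1"
  shows "(\<integral>\<^sup>+x. ennreal_powr (f x) \<theta> * ennreal_powr (g x) (1 - \<theta>) \<partial>M)
    \<le> ennreal_powr (\<integral>\<^sup>+x. f x \<partial>M) \<theta> * ennreal_powr (\<integral>\<^sup>+x. g x \<partial>M) (1 - \<theta>)"
    (is "?I \<le> ennreal_powr ?a _ * ennreal_powr ?b _")
proof (cases "?a = 0 \<or> ?b = 0")
  case True
  then have "(AE x in M. f x = 0) \<or> (AE x in M. g x = 0)"
    by (simp add: nn_integral_0_iff_AE)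
  then have "AE x in M. ennreal_powr (f x) \<theta> * ennreal_powr (g x) (1 - \<theta>) = 0"
  proof
    assume "AE x in M. f x = 0" then show ?thesis by eventually_elim simp
  next
    assume "AE x in M. g x = 0" then show ?thesis by eventually_elim simp
  qed
  then have "?I = 0"
    by (simp add: nn_integral_0_iff_AE)
  then show ?thesis by simp
next
  case nz: False
  show ?thesis
  proof (cases "?a = \<infinity> \<or> ?b = \<infinity>")
    case True
    with nz have "ennreal_powr ?a \<theta> * ennreal_powr ?b (1 - \<theta>) = \<infinity>"
      by (auto simp: ennreal_top_mult ennreal_mult_top)
    then show ?thesis by simp
  next
    case False
    with nz obtain a b where ab: "?a = ennreal a" "?b = ennreal b" "0 < a" "0 < b"
      by (cases ?a; cases ?b) (auto simp: less_le)
    \<comment> \<open>\<open>c\<close> is the right-hand side; \<open>u\<close> and \<open>w\<close> normalise the two integrals to 1.\<close>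
    define c where "c = ennreal (a powr \<theta> * b powr (1 - \<theta>))"
    define u where "u = ennreal (inverse a)"
    define w where "w = ennreal (inverse b)"
    have ua: "u * ?a = 1" and wb: "w * ?b = 1"
      using ab by (simp_all add: u_def w_def ennreal_mult' [symmetric])
    have "a powr \<theta> * b powr (1 - \<theta>) * (inverse a powr \<theta> * inverse b powr (1 - \<theta>)) = 1"
      using ab by (simp add: inverse_powr) (simp add: field_simps)
    then have c: "c * (ennreal_powr u \<theta> * ennreal_powr w (1 - \<theta>)) = 1"
      using ab by (simp add: c_def u_def w_def ennreal_powr_ennreal ennreal_mult' [symmetric])
    have "?I = (\<integral>\<^sup>+x. c * (ennreal_powr (u * f x) \<theta> * ennreal_powr (w * g x) (1 - \<theta>)) \<partial>M)"
    proof (rule nn_integral_cong)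
      fix x
      have "c * (ennreal_powr (u * f x) \<theta> * ennreal_powr (w * g x) (1 - \<theta>)) =
        (c * (ennreal_powr u \<theta> * ennreal_powr w (1 - \<theta>))) *
        (ennreal_powr (f x) \<theta> * ennreal_powr (g x) (1 - \<theta>))"
        using \<theta> by (simp add: ennreal_powr_mult ac_simps)
      then show "ennreal_powr (f x) \<theta> * ennreal_powr (g x) (1 - \<theta>) =
        c * (ennreal_powr (u * f x) \<theta> * ennreal_powr (w * g x) (1 - \<theta>))"
        using c by simp
    qed
    also have "\<dots> \<le> (\<integral>\<^sup>+x. c * (ennreal \<theta> * (u * f x) + ennreal (1 - \<theta>) * (w * g x)) \<partial>M)"
      by (intro nn_integral_mono mult_left_mono weighted_AM_GM_ennreal \<theta>) simp
    also have "\<dots> = c * (ennreal \<theta> * (u * ?a) + ennreal (1 - \<theta>) * (w * ?b))"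
      by (simp add: nn_integral_cmult nn_integral_add)
    also have "\<dots> = c"
      using \<theta> by (simp add: ua wb ennreal_plus [symmetric] del: ennreal_plus)
    also have "c = ennreal_powr ?a \<theta> * ennreal_powr ?b (1 - \<theta>)"
      using ab by (simp add: c_def ennreal_powr_ennreal ennreal_mult')
    finally show ?thesis .
  qed
qed

text \<open>
  Let \<open>N t\<close> be the \<open>q\<close>-norm of \<open>F (-, t)\<close> and \<open>J = \<integral> N\<close>. Hoelder's inequality in \<open>t\<close>, applied to
  \<open>F = (F^q N^(1 - q))^(1 / q) * N^(1 - 1 / q)\<close> where \<open>N\<close> is positive and finite, gives for fixed \<open>x\<close>
  \<open>(\<integral> F dt)^q \<le> (\<integral> F^q N^(1 - q) dt) * J^(q - 1)\<close>. Integrating over \<open>x\<close> and exchanging the order of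
  integration, the first factor becomes \<open>\<integral> N^q N^(1 - q) dt = J\<close>. Unlike the argument by
  duality, this never divides by the norm of \<open>\<integral> F dt\<close>, which might be infinite, so no truncation
  occurs.
\<close>

lemma (in pair_sigma_finite) Minkowski_nn_integral:
  assumes F [measurable]: "(\<lambda>(x, t). F x t) \<in> borel_measurable (M1 \<Otimes>\<^sub>M M2)"
    and q: "1 < q"
  shows "ennreal_powr (\<integral>\<^sup>+x. ennreal_powr (\<integral>\<^sup>+t. F x t \<partial>M2) q \<partial>M1) (1 / q)
    \<le> (\<integral>\<^sup>+t. ennreal_powr (\<integral>\<^sup>+x. ennreal_powr (F x t) q \<partial>M1) (1 / q) \<partial>M2)"
proof -
  define N where "N t = ennreal_powr (\<integral>\<^sup>+x. ennreal_powr (F x t) q \<partial>M1) (1 / q)" for t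
  define J where "J = (\<integral>\<^sup>+t. N t \<partial>M2)"
  define R where "R t = ennreal_powr (N t) (1 - q)" for t
  have N_meas [measurable]: "N \<in> borel_measurable M2"
    unfolding N_def by measurable
  have R_meas [measurable]: "R \<in> borel_measurable M2"
    unfolding R_def by measurable
  have N_powr: "ennreal_powr (N t) q = (\<integral>\<^sup>+x. ennreal_powr (F x t) q \<partial>M1)" for t
    using q by (simp add: N_def ennreal_powr_powr)
  \<comment> \<open>The factorisation of \<open>F\<close> fails where \<open>N t = 0 < F x t\<close>; by Tonelli this is negligible
    for almost every \<open>x\<close>.\<close>
  have [measurable]: "{z \<in> space (M1 \<Otimes>\<^sub>M M2). 0 < F (fst z) (snd z) \<longrightarrow> 0 < N (snd z)}
      \<in> sets (M1 \<Otimes>\<^sub>M M2)"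
    by measurable
  have "AE t in M2. AE x in M1. 0 < F x t \<longrightarrow> 0 < N t"
  proof (rule AE_I2)
    fix t assume [measurable]: "t \<in> space M2"
    show "AE x in M1. 0 < F x t \<longrightarrow> 0 < N t"
      by (cases "N t = 0") (simp_all add: N_def nn_integral_0_iff_AE zero_less_iff_neq_zero)
  qed
  then have zero: "AE x in M1. AE t in M2. 0 < F x t \<longrightarrow> 0 < N t"
    by (subst AE_commute) simp_all
  have split: "a \<le> ennreal_powr (ennreal_powr a q * ennreal_powr b (1 - q)) (1 / q) *
      ennreal_powr b (1 - 1 / q)" if "b = 0 \<longrightarrow> a = 0" for a b
  proof (cases "a = 0 \<or> b = 0 \<or> a = top \<or> b = top")
    case True
    then show ?thesis
      using that q by (auto simp: ennreal_top_mult ennreal_mult_top)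
  next
    case False
    then obtain u w where uw: "a = ennreal u" "b = ennreal w" "0 < u" "0 < w"
      by (cases a; cases b) (auto simp: less_le)
    have "(u powr q * w powr (1 - q)) powr (1 / q) * w powr (1 - 1 / q) =
      u * (w powr ((1 - q) / q) * w powr (1 - 1 / q))"
      using uw q by (simp add: powr_mult powr_powr)
    also have "\<dots> = u * w powr ((1 - q) / q + (1 - 1 / q))"
      by (simp only: powr_add)
    also have "(1 - q) / q + (1 - 1 / q) = 0"
      using q by (simp add: field_simps)
    finally show ?thesis
      using uw by (simp add: ennreal_powr_ennreal ennreal_mult' [symmetric])
  qed
  have "(\<integral>\<^sup>+x. ennreal_powr (\<integral>\<^sup>+t. F x t \<partial>M2) q \<partial>M1)
    \<le> (\<integral>\<^sup>+x. (\<integral>\<^sup>+t. ennreal_powr (F x t) q * R t \<partial>M2) * ennreal_powr J (q - 1) \<partial>M1)"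
  proof (rule nn_integral_mono_AE)
    show "AE x in M1. ennreal_powr (\<integral>\<^sup>+t. F x t \<partial>M2) q
      \<le> (\<integral>\<^sup>+t. ennreal_powr (F x t) q * R t \<partial>M2) * ennreal_powr J (q - 1)"
      using zero AE_space
    proof eventually_elim
      case (elim x)
      note [measurable] = elim(2)
      have "(\<integral>\<^sup>+t. F x t \<partial>M2) \<le> (\<integral>\<^sup>+t. ennreal_powr (ennreal_powr (F x t) q * R t) (1 / q) *
          ennreal_powr (N t) (1 - 1 / q) \<partial>M2)"
        using elim(1) by (intro nn_integral_mono_AE) (auto simp: R_def zero_less_iff_neq_zero elim!: eventually_mono intro!: split)
      also have "\<dots> \<le> ennreal_powr (\<integral>\<^sup>+t. ennreal_powr (F x t) q * R t \<partial>M2) (1 / q) *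
          ennreal_powr J (1 - 1 / q)"
        unfolding J_def using q by (intro Holder_nn_integral) auto
      finally have "ennreal_powr (\<integral>\<^sup>+t. F x t \<partial>M2) q \<le>
        ennreal_powr (ennreal_powr (\<integral>\<^sup>+t. ennreal_powr (F x t) q * R t \<partial>M2) (1 / q) *
          ennreal_powr J (1 - 1 / q)) q"
        using q by (intro ennreal_powr_mono) auto
      also have "\<dots> = (\<integral>\<^sup>+t. ennreal_powr (F x t) q * R t \<partial>M2) * ennreal_powr J (q - 1)"
        using q by (simp add: ennreal_powr_mult ennreal_powr_powr left_diff_distrib)
      finally show ?case .
    qed
  qed
  also have "\<dots> = (\<integral>\<^sup>+x. \<integral>\<^sup>+t. ennreal_powr (F x t) q * R t \<partial>M2 \<partial>M1) * ennreal_powr J (q - 1)"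
    by (simp add: nn_integral_multc)
  also have "(\<integral>\<^sup>+x. \<integral>\<^sup>+t. ennreal_powr (F x t) q * R t \<partial>M2 \<partial>M1) =
      (\<integral>\<^sup>+t. \<integral>\<^sup>+x. ennreal_powr (F x t) q * R t \<partial>M1 \<partial>M2)"
    by (rule Fubini' [symmetric]) measurable
  also have "\<dots> = (\<integral>\<^sup>+t. ennreal_powr (N t) q * R t \<partial>M2)"
    by (intro nn_integral_cong) (simp add: N_powr nn_integral_multc)
  also have "\<dots> \<le> J"
    unfolding J_def
  proof (rule nn_integral_mono)
    fix t
    show "ennreal_powr (N t) q * R t \<le> N t"
    proof (cases "N t")
      case (real r)
      then have "ennreal_powr (N t) q * R t = ennreal (r powr q * r powr (1 - q))"
        by (simp add: R_def ennreal_powr_ennreal ennreal_mult')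
      also have "\<dots> = ennreal (r powr 1)"
        by (simp add: powr_add [symmetric])
      finally show ?thesis using real by simp
    qed simp
  qed
  finally have "(\<integral>\<^sup>+x. ennreal_powr (\<integral>\<^sup>+t. F x t \<partial>M2) q \<partial>M1) \<le> J * ennreal_powr J (q - 1)"
    by (simp add: mult_right_mono)
  also have "\<dots> = ennreal_powr J q"
    using ennreal_powr_add [of 1 "q - 1" J] q by simp
  finally have "ennreal_powr (\<integral>\<^sup>+x. ennreal_powr (\<integral>\<^sup>+t. F x t \<partial>M2) q \<partial>M1) (1 / q)
      \<le> ennreal_powr (ennreal_powr J q) (1 / q)"
    using q by (intro ennreal_powr_mono) auto
  then show ?thesis
    using q by (simp add: ennreal_powr_powr J_def N_def)
qed

section \<open>Dilations of the plane\<close>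

lemma borel_measurable_plane_scale:
  fixes a b :: real
  shows "(\<lambda>y. (a * fst y, b * snd y)) \<in> borel_measurable borel"
  by (intro borel_measurable_continuous_onI continuous_intros)

lemma nn_integral_lborel_plane_scale:
  fixes a b :: real and g :: "real \<times> real \<Rightarrow> ennreal"
  assumes g: "g \<in> borel_measurable borel" and ab: "a \<noteq> 0" "b \<noteq> 0"
  shows "(\<integral>\<^sup>+x. g x \<partial>lborel) = ennreal \<bar>a * b\<bar> * (\<integral>\<^sup>+y. g (a * fst y, b * snd y) \<partial>lborel)"
proof -
  have [measurable]: "g \<in> borel_measurable (borel \<Otimes>\<^sub>M borel)"
    using g by (simp only: borel_prod)
  have scaled: "(\<lambda>y. g (a * fst y, b * snd y)) \<in> borel_measurable (lborel \<Otimes>\<^sub>M lborel)"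
    using measurable_compose [OF borel_measurable_plane_scale g] by (simp add: lborel_prod)
  have "(\<integral>\<^sup>+x. g x \<partial>lborel) = (\<integral>\<^sup>+x1. \<integral>\<^sup>+x2. g (x1, x2) \<partial>lborel \<partial>lborel)"
    unfolding lborel_prod [symmetric] by (rule lborel.nn_integral_fst [symmetric]) measurable
  also have "\<dots> = (\<integral>\<^sup>+x1. ennreal \<bar>b\<bar> * (\<integral>\<^sup>+x2. g (x1, b * x2) \<partial>lborel) \<partial>lborel)"
    by (intro nn_integral_cong, subst nn_integral_real_affine [where c = b and t = 0]) (simp_all add: ab)
  also have "\<dots> = ennreal \<bar>b\<bar> * (\<integral>\<^sup>+x1. \<integral>\<^sup>+x2. g (x1, b * x2) \<partial>lborel \<partial>lborel)"
    by (rule nn_integral_cmult) measurable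
  also have "(\<integral>\<^sup>+x1. \<integral>\<^sup>+x2. g (x1, b * x2) \<partial>lborel \<partial>lborel) =
      ennreal \<bar>a\<bar> * (\<integral>\<^sup>+x1. \<integral>\<^sup>+x2. g (a * x1, b * x2) \<partial>lborel \<partial>lborel)"
    by (subst nn_integral_real_affine [where c = a and t = 0]) (simp_all add: ab)
  also have "(\<integral>\<^sup>+x1. \<integral>\<^sup>+x2. g (a * x1, b * x2) \<partial>lborel \<partial>lborel) =
      (\<integral>\<^sup>+y. g (a * fst y, b * snd y) \<partial>lborel)"
    using lborel.nn_integral_fst [OF scaled] by (simp add: lborel_prod)
  finally show ?thesis
    by (simp add: abs_mult ennreal_mult' ac_simps)
qed

lemma AE_lborel_plane_scale:
  fixes a b :: real
  assumes "AE x in lborel. P x" and ab: "a \<noteq> 0" "b \<noteq> 0"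
  shows "AE y in lborel. P (a * fst y, b * snd y)"
proof -
  obtain N :: "(real \<times> real) set" where N: "N \<in> null_sets lborel" "{x. \<not> P x} \<subseteq> N"
    using assms(1) by (auto elim!: AE_E simp: null_sets_def)
  then have [measurable]: "N \<in> sets borel"
    by (auto simp: null_sets_def)
  have "0 = (\<integral>\<^sup>+x. indicator N x \<partial>lborel)"
    using N by auto
  also have "\<dots> = ennreal \<bar>a * b\<bar> * (\<integral>\<^sup>+y. indicator N (a * fst y, b * snd y) \<partial>lborel)"
    using ab by (intro nn_integral_lborel_plane_scale) measurable
  finally have "(\<integral>\<^sup>+y. indicator N (a * fst y, b * snd y) \<partial>(lborel :: (real \<times> real) measure)) = 0"
    using ab by simp
  then have "AE y in lborel :: (real \<times> real) measure. indicator N (a * fst y, b * snd y) = (0 :: ennreal)"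
    by (subst (asm) nn_integral_0_iff_AE)
       (simp_all add: measurable_compose [OF borel_measurable_plane_scale])
  then show ?thesis
    by eventually_elim (use N(2) in \<open>auto simp: indicator_def split: if_splits\<close>)
qed

lemma AE_lborel_coordinates_nonzero:
  "AE t in lborel :: (real \<times> real) measure. fst t \<noteq> 0 \<and> snd t \<noteq> 0"
proof -
  have "{0} \<times> UNIV \<in> null_sets (lborel \<Otimes>\<^sub>M lborel :: (real \<times> real) measure)"
    "UNIV \<times> {0} \<in> null_sets (lborel \<Otimes>\<^sub>M lborel :: (real \<times> real) measure)"
    by (auto simp: null_sets_def lborel.emeasure_pair_measure_Times)
  then have "AE t in lborel :: (real \<times> real) measure. t \<notin> {0} \<times> UNIV"
    "AE t in lborel :: (real \<times> real) measure. t \<notin> UNIV \<times> {0}"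
    unfolding lborel_prod by (auto intro: AE_not_in)
  then show ?thesis
    by eventually_elim (auto simp: mem_Times_iff)
qed

lemma borel_measurable_plane_quotient:
  "(\<lambda>z. (fst (fst z) / fst (snd z), snd (fst z) / snd (snd z)) :: real \<times> real)
    \<in> borel_measurable (lborel \<Otimes>\<^sub>M lborel)"
  unfolding lborel_prod [symmetric] borel_prod [symmetric] by measurable

text \<open>
  For fixed \<open>t\<close> off the axes the exceptional set of \<open>x\<close> is a dilated null set; Tonelli's theorem
  exchanges the roles of \<open>x\<close> and \<open>t\<close>, so that the change of variables \<open>t \<mapsto> x / t\<close> is avoided.
\<close>

lemma AE_AE_quotient:
  assumes "AE x in lborel :: (real \<times> real) measure. P x"
  shows "AE x in lborel. AE t in lborel. P (fst x / fst t, snd x / snd t)"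
proof -
  \<comment> \<open>Exchanging the two quantifiers needs a measurable predicate, which a Borel null set provides.\<close>
  obtain N :: "(real \<times> real) set" where N: "N \<in> null_sets lborel" "{x. \<not> P x} \<subseteq> N"
    using assms by (auto elim!: AE_E simp: null_sets_def)
  then have [measurable]: "N \<in> sets borel"
    by (auto simp: null_sets_def)
  have meas: "{z \<in> space (lborel \<Otimes>\<^sub>M lborel). (fst (fst z) / fst (snd z), snd (fst z) / snd (snd z)) \<notin> N}
      \<in> sets (lborel \<Otimes>\<^sub>M lborel)"
    using borel_measurable_plane_quotient by measurable
  have "AE x in lborel. x \<notin> N"
    using N by (rule_tac AE_not_in)
  then have *: "AE x in lborel. (fst x / a, snd x / b) \<notin> N" if "a \<noteq> 0" "b \<noteq> 0" for a b
    using AE_lborel_plane_scale [of "\<lambda>x. x \<notin> N" "1 / a" "1 / b"] that by simp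
  have "AE t in lborel. AE x in lborel. (fst x / fst t, snd x / snd t) \<notin> N"
    using AE_lborel_coordinates_nonzero by eventually_elim (use * in auto)
  then have "AE x in lborel. AE t in lborel. (fst x / fst t, snd x / snd t) \<notin> N"
    by (subst lborel_pair.AE_commute) (use meas in simp_all)
  then show ?thesis
    by (rule eventually_mono) (rule eventually_mono, use N(2) in auto)
qed

section \<open>The norm of a dilation and of a superposition of dilations\<close>

abbreviation (input) dilate :: "real \<times> real \<Rightarrow> real \<times> real \<Rightarrow> real \<times> real" where
  "dilate t y \<equiv> (fst t * fst y, snd t * snd y)"

abbreviation (input) undilate :: "real \<times> real \<Rightarrow> real \<times> real \<Rightarrow> real \<times> real" where
  "undilate x t \<equiv> (fst x / fst t, snd x / snd t)"

text \<open>
  Up to the factor \<open>|t1 t2|^(1 / q)\<close>, this bounds the norm of \<open>f \<mapsto> f (x / t)\<close> between the two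
  weighted spaces; it is the inner factor of \<open>D_sup\<close>.
\<close>

definition dilation_constant ::
  "real \<Rightarrow> real \<Rightarrow> (real \<times> real \<Rightarrow> ennreal) \<Rightarrow> (real \<times> real \<Rightarrow> ennreal) \<Rightarrow> real \<times> real \<Rightarrow> ennreal" where
  "dilation_constant p q v w t =
     ennreal_powr
       (\<integral>\<^sup>+y. ennreal_powr (v (dilate t y)) (p / (p - q)) / ennreal_powr (w y) (q / (p - q)) \<partial>lborel)
       ((p - q) / (p * q))"

text \<open>
  The change of variables \<open>x = t y\<close> followed by Hoelder's inequality with \<open>\<theta> = q / p\<close>. The factor
  \<open>w^(q / p)\<close> put into the first function is cancelled by the denominator of the second one; this
  cancellation is where \<open>w\<close> has to be positive and finite almost everywhere.
\<close>

lemma nn_integral_dilation_le: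
  fixes f v w :: "real \<times> real \<Rightarrow> ennreal"
  assumes [measurable]: "f \<in> borel_measurable borel" "v \<in> borel_measurable borel"
      "w \<in> borel_measurable borel"
    and w: "AE y in lborel. 0 < w y \<and> w y < top"
    and pq: "0 < q" "q < p" and t: "fst t \<noteq> 0" "snd t \<noteq> 0"
  shows "ennreal_powr (\<integral>\<^sup>+x. ennreal_powr (f (undilate x t)) q * v x \<partial>lborel) (1 / q)
    \<le> ennreal (\<bar>fst t * snd t\<bar> powr (1 / q)) * dilation_constant p q v w t *
       ennreal_powr (\<integral>\<^sup>+y. ennreal_powr (f y) p * w y \<partial>lborel) (1 / p)"
proof -
  define A where "A y = ennreal_powr (f y) p * w y" for y
  define B where "B y = ennreal_powr (v (dilate t y)) (p / (p - q)) / ennreal_powr (w y) (q / (p - q))" for y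
  define \<theta> where "\<theta> = q / p"
  have \<theta>: "0 < \<theta>" "\<theta> < 1" "1 - \<theta> = (p - q) / p"
    using pq by (simp_all add: \<theta>_def field_simps)
  have [measurable]: "(\<lambda>y. v (dilate t y)) \<in> borel_measurable borel"
    "(\<lambda>x. f (undilate x t)) \<in> borel_measurable borel"
    using measurable_compose [OF borel_measurable_plane_scale, of v borel "fst t" "snd t"]
      measurable_compose [OF borel_measurable_plane_scale, of f borel "1 / fst t" "1 / snd t"]
    by simp_all
  have [measurable]: "A \<in> borel_measurable borel" "B \<in> borel_measurable borel"
    unfolding A_def B_def by measurable
  have "(\<integral>\<^sup>+x. ennreal_powr (f (undilate x t)) q * v x \<partial>lborel) =
      ennreal \<bar>fst t * snd t\<bar> * (\<integral>\<^sup>+y. ennreal_powr (f y) q * v (dilate t y) \<partial>lborel)"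
    using t by (subst nn_integral_lborel_plane_scale [of _ "fst t" "snd t"]) simp_all
  also have "(\<integral>\<^sup>+y. ennreal_powr (f y) q * v (dilate t y) \<partial>lborel)
      \<le> (\<integral>\<^sup>+y. ennreal_powr (A y) \<theta> * ennreal_powr (B y) (1 - \<theta>) \<partial>lborel)"
  proof (rule nn_integral_mono_AE)
    show "AE y in lborel. ennreal_powr (f y) q * v (dilate t y)
        \<le> ennreal_powr (A y) \<theta> * ennreal_powr (B y) (1 - \<theta>)"
      using w
    proof eventually_elim
      case (elim y)
      then obtain c where c: "w y = ennreal c" "0 < c"
        by (cases "w y") auto
      have "ennreal_powr (B y) (1 - \<theta>) =
          ennreal_powr (ennreal_powr (v (dilate t y)) (p / (p - q))) (1 - \<theta>) * ennreal (c powr - \<theta>)"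
        using \<theta> pq c
        by (simp add: B_def divide_ennreal_def ennreal_powr_mult ennreal_powr_ennreal
            inverse_ennreal powr_minus [symmetric] powr_powr)
           (simp add: \<theta>_def)
      then have B: "ennreal_powr (B y) (1 - \<theta>) = v (dilate t y) * ennreal (c powr - \<theta>)"
        using \<theta> pq by (simp add: ennreal_powr_powr)
      have A: "ennreal_powr (A y) \<theta> = ennreal_powr (f y) q * ennreal (c powr \<theta>)"
        using \<theta> pq c
        by (simp add: A_def ennreal_powr_mult ennreal_powr_powr ennreal_powr_ennreal)
           (simp add: \<theta>_def)
      have one: "ennreal (c powr \<theta>) * ennreal (c powr - \<theta>) = 1"
        using c by (simp add: ennreal_mult' [symmetric] powr_add [symmetric])
      have "ennreal_powr (A y) \<theta> * ennreal_powr (B y) (1 - \<theta>) =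
          ennreal_powr (f y) q * v (dilate t y) * (ennreal (c powr \<theta>) * ennreal (c powr - \<theta>))"
        unfolding A B by (simp only: ac_simps)
      then have "ennreal_powr (A y) \<theta> * ennreal_powr (B y) (1 - \<theta>) = ennreal_powr (f y) q * v (dilate t y)"
        unfolding one by simp
      then show ?case by simp
    qed
  qed
  also have "\<dots> \<le> ennreal_powr (\<integral>\<^sup>+y. A y \<partial>lborel) \<theta> * ennreal_powr (\<integral>\<^sup>+y. B y \<partial>lborel) (1 - \<theta>)"
    using \<theta> by (intro Holder_nn_integral) simp_all
  finally have "(\<integral>\<^sup>+x. ennreal_powr (f (undilate x t)) q * v x \<partial>lborel) \<le> ennreal \<bar>fst t * snd t\<bar> *
      (ennreal_powr (\<integral>\<^sup>+y. A y \<partial>lborel) \<theta> * ennreal_powr (\<integral>\<^sup>+y. B y \<partial>lborel) (1 - \<theta>))"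
    by (simp add: mult_left_mono)
  then have "ennreal_powr (\<integral>\<^sup>+x. ennreal_powr (f (undilate x t)) q * v x \<partial>lborel) (1 / q)
      \<le> ennreal_powr (ennreal \<bar>fst t * snd t\<bar> *
      (ennreal_powr (\<integral>\<^sup>+y. A y \<partial>lborel) \<theta> * ennreal_powr (\<integral>\<^sup>+y. B y \<partial>lborel) (1 - \<theta>))) (1 / q)"
    using pq by (intro ennreal_powr_mono) auto
  also have "\<dots> = ennreal (\<bar>fst t * snd t\<bar> powr (1 / q)) *
      (ennreal_powr (\<integral>\<^sup>+y. A y \<partial>lborel) (\<theta> / q) * ennreal_powr (\<integral>\<^sup>+y. B y \<partial>lborel) ((1 - \<theta>) / q))"
    using pq by (simp add: ennreal_powr_mult ennreal_powr_powr ennreal_powr_ennreal)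
  also have "\<theta> / q = 1 / p"
    using pq by (simp add: \<theta>_def)
  also have "(1 - \<theta>) / q = (p - q) / (p * q)"
    using \<theta> by simp
  finally show ?thesis
    by (simp add: dilation_constant_def A_def B_def ac_simps)
qed

lemma borel_measurable_plane_dilation:
  "(\<lambda>z. dilate (fst z) (snd z)) \<in> borel_measurable (lborel \<Otimes>\<^sub>M lborel)"
  unfolding lborel_prod [symmetric] borel_prod [symmetric] by measurable

lemma borel_measurable_dilation_constant:
  assumes v: "v \<in> borel_measurable borel" and [measurable]: "w \<in> borel_measurable borel"
  shows "dilation_constant p q v w \<in> borel_measurable borel"
proof -
  have [measurable]: "(\<lambda>z. v (dilate (fst z) (snd z))) \<in> borel_measurable (lborel \<Otimes>\<^sub>M lborel)"
    using v by (rule measurable_compose [OF borel_measurable_plane_dilation])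
  have "(\<lambda>(t, y). ennreal_powr (v (dilate t y)) (p / (p - q)) / ennreal_powr (w y) (q / (p - q)))
      \<in> borel_measurable (lborel \<Otimes>\<^sub>M lborel)"
    unfolding case_prod_beta' by measurable
  then have [measurable]: "(\<lambda>t. \<integral>\<^sup>+y. ennreal_powr (v (dilate t y)) (p / (p - q)) /
      ennreal_powr (w y) (q / (p - q)) \<partial>lborel) \<in> borel_measurable lborel"
    by (rule lborel.borel_measurable_nn_integral)
  have "dilation_constant p q v w \<in> borel_measurable lborel"
    unfolding dilation_constant_def [abs_def] by (rule measurable_ennreal_powr) fact
  then show ?thesis by simp
qed

lemma borel_measurable_coordinate_product:
  "(\<lambda>t :: real \<times> real. \<bar>fst t * snd t\<bar> powr r) \<in> borel_measurable borel"
proof -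
  have [measurable]: "(\<lambda>t :: real \<times> real. \<bar>fst t * snd t\<bar>) \<in> borel_measurable borel"
    by (intro borel_measurable_continuous_onI continuous_intros)
  show ?thesis
    by measurable
qed

text \<open>
  Minkowski's inequality combined with the bound for each single dilation. The values of \<open>t\<close>
  on the axes, where the dilation degenerates, are negligible.
\<close>

lemma Hausdorff_norm_le:
  fixes f v w k :: "real \<times> real \<Rightarrow> ennreal"
  assumes f [measurable]: "f \<in> borel_measurable borel"
    and [measurable]: "v \<in> borel_measurable borel"
      "w \<in> borel_measurable borel" "k \<in> borel_measurable borel"
    and w: "AE y in lborel. 0 < w y \<and> w y < top"
    and pq: "1 < q" "q < p"
  shows "ennreal_powr (\<integral>\<^sup>+x. ennreal_powr (\<integral>\<^sup>+t. k t * f (undilate x t) \<partial>lborel) q * v x \<partial>lborel) (1 / q)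
    \<le> (\<integral>\<^sup>+t. k t * (ennreal (\<bar>fst t * snd t\<bar> powr (1 / q)) * dilation_constant p q v w t) \<partial>lborel) *
       ennreal_powr (\<integral>\<^sup>+y. ennreal_powr (f y) p * w y \<partial>lborel) (1 / p)"
proof -
  \<comment> \<open>The weight is absorbed into the integrand: Lebesgue measure is \<open>\<sigma>\<close>-finite, whereas the
    measure with density \<open>v\<close> is not if \<open>v\<close> is infinite on a set of positive measure.\<close>
  define F where "F x t = k t * f (undilate x t) * ennreal_powr (v x) (1 / q)" for x t
  have fq [measurable]: "(\<lambda>z. f (undilate (fst z) (snd z))) \<in> borel_measurable (lborel \<Otimes>\<^sub>M lborel)"
    by (rule measurable_compose [OF borel_measurable_plane_quotient f])
  have fx [measurable]: "(\<lambda>x. f (undilate x t)) \<in> borel_measurable lborel" for t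
    using measurable_compose [OF borel_measurable_plane_scale f, of "1 / fst t" "1 / snd t"] by simp
  have ft [measurable]: "(\<lambda>t. f (undilate x t)) \<in> borel_measurable lborel" for x
    using measurable_Pair2 [OF fq, of x] by simp
  have "(\<lambda>z. k (snd z) * f (undilate (fst z) (snd z)) * ennreal_powr (v (fst z)) (1 / q))
      \<in> borel_measurable (lborel \<Otimes>\<^sub>M lborel)"
    using fq by measurable
  then have F: "(\<lambda>(x, t). F x t) \<in> borel_measurable (lborel \<Otimes>\<^sub>M lborel)"
    by (simp add: F_def case_prod_beta)
  have "ennreal_powr (\<integral>\<^sup>+x. ennreal_powr (\<integral>\<^sup>+t. k t * f (undilate x t) \<partial>lborel) q * v x \<partial>lborel) (1 / q) =
      ennreal_powr (\<integral>\<^sup>+x. ennreal_powr (\<integral>\<^sup>+t. F x t \<partial>lborel) q \<partial>lborel) (1 / q)"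
    using pq by (simp add: F_def nn_integral_multc ennreal_powr_mult ennreal_powr_powr)
  also have "\<dots> \<le> (\<integral>\<^sup>+t. ennreal_powr (\<integral>\<^sup>+x. ennreal_powr (F x t) q \<partial>lborel) (1 / q) \<partial>lborel)"
    using F pq by (intro lborel_pair.Minkowski_nn_integral)
  also have "\<dots> = (\<integral>\<^sup>+t. k t * ennreal_powr (\<integral>\<^sup>+x. ennreal_powr (f (undilate x t)) q * v x \<partial>lborel) (1 / q) \<partial>lborel)"
    using pq by (simp add: F_def nn_integral_cmult ennreal_powr_mult ennreal_powr_powr mult.assoc)
  also have "\<dots> \<le> (\<integral>\<^sup>+t. k t * (ennreal (\<bar>fst t * snd t\<bar> powr (1 / q)) * dilation_constant p q v w t) *
       ennreal_powr (\<integral>\<^sup>+y. ennreal_powr (f y) p * w y \<partial>lborel) (1 / p) \<partial>lborel)"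
  proof (rule nn_integral_mono_AE)
    show "AE t in lborel. k t * ennreal_powr (\<integral>\<^sup>+x. ennreal_powr (f (undilate x t)) q * v x \<partial>lborel) (1 / q)
      \<le> k t * (ennreal (\<bar>fst t * snd t\<bar> powr (1 / q)) * dilation_constant p q v w t) *
       ennreal_powr (\<integral>\<^sup>+y. ennreal_powr (f y) p * w y \<partial>lborel) (1 / p)"
      using AE_lborel_coordinates_nonzero
    proof eventually_elim
      case (elim t)
      then show ?case
        using nn_integral_dilation_le [of f v w q p t] w pq by (simp add: mult.assoc mult_left_mono)
    qed
  qed
  also have "\<dots> = (\<integral>\<^sup>+t. k t * (ennreal (\<bar>fst t * snd t\<bar> powr (1 / q)) * dilation_constant p q v w t) \<partial>lborel) *
       ennreal_powr (\<integral>\<^sup>+y. ennreal_powr (f y) p * w y \<partial>lborel) (1 / p)"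
  proof (rule nn_integral_multc)
    note [measurable] = borel_measurable_coordinate_product borel_measurable_dilation_constant
    show "(\<lambda>t. k t * (ennreal (\<bar>fst t * snd t\<bar> powr (1 / q)) * dilation_constant p q v w t))
        \<in> borel_measurable lborel"
      by measurable
  qed
  finally show ?thesis .
qed

section \<open>Passage from Lebesgue to Borel measurable functions\<close>

lemma complex_Borel_representative:
  fixes f :: "'a \<Rightarrow> complex"
  assumes "f \<in> borel_measurable (completion M)"
  obtains g where "g \<in> borel_measurable M" "AE x in M. f x = g x"
proof -
  have "(\<lambda>x. Re (f x)) \<in> borel_measurable (completion M)" "(\<lambda>x. Im (f x)) \<in> borel_measurable (completion M)"
    using assms by measurable
  note parts = this [THEN completion_ex_borel_measurable_real]
  obtain a where [measurable]: "a \<in> borel_measurable M" and a: "AE x in M. Re (f x) = a x"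
    using parts(1) by (rule bexE)
  obtain b where [measurable]: "b \<in> borel_measurable M" and b: "AE x in M. Im (f x) = b x"
    using parts(2) by (rule bexE)
  show ?thesis
  proof
    show "(\<lambda>x. complex_of_real (a x) + \<i> * complex_of_real (b x)) \<in> borel_measurable M"
      by measurable
    show "AE x in M. f x = complex_of_real (a x) + \<i> * complex_of_real (b x)"
      using a b by eventually_elim (simp add: complex_eq_iff)
  qed
qed

lemma D_sup_eq:
  "D_sup \<alpha> p q v w \<phi> =
    (\<integral>\<^sup>+t. ennreal (norm (\<phi> t) / \<bar>fst t * snd t\<bar> powr (2 * \<alpha> + 2 - 1 / q)) *
       dilation_constant p q v w t \<partial>lborel)"
  by (simp add: D_sup_def dilation_constant_def case_prod_beta' nn_integral_completion)

lemma dilation_constant_cong_AE: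
  assumes "AE y in lborel. v y = v' y" "AE y in lborel. w y = w' y"
    and t: "fst t \<noteq> 0" "snd t \<noteq> 0"
  shows "dilation_constant p q v w t = dilation_constant p q v' w' t"
proof -
  have "AE y in lborel. v (dilate t y) = v' (dilate t y)"
    using AE_lborel_plane_scale [OF assms(1) t] .
  with assms(2) have "AE y in lborel.
      ennreal_powr (v (dilate t y)) (p / (p - q)) / ennreal_powr (w y) (q / (p - q)) =
      ennreal_powr (v' (dilate t y)) (p / (p - q)) / ennreal_powr (w' y) (q / (p - q))"
    by eventually_elim simp
  then show ?thesis
    unfolding dilation_constant_def
    by (rule arg_cong [OF nn_integral_cong_AE, where f = "\<lambda>I. ennreal_powr I ((p - q) / (p * q))"])
qed

section \<open>Boundedness of the Dunkl-Hausdorff operator\<close>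

text \<open>
  The bound is first obtained for \<open>G\<close>, the operator applied to absolute values of the Borel
  representatives. Its finiteness almost everywhere makes the integral converge absolutely, and
  \<open>|H f| \<le> G\<close> then transfers the bound. The primed functions are the representatives.
\<close>

lemma dunkl_hausdorff_estimate:
  fixes p q \<alpha> :: real
    and v w :: "real \<times> real \<Rightarrow> ennreal"
    and \<phi> f :: "real \<times> real \<Rightarrow> complex"
  assumes pq: "1 < q" "q < p"
    and v: "weight_function v" and w: "weight_function w"
    and \<phi>: "\<phi> \<in> borel_measurable lebesgue"
    and D: "D_sup \<alpha> p q v w \<phi> < \<infinity>"
    and f: "f \<in> weighted_Lebesgue p w"
  shows "AE x in lebesgue. integrable lebesgue (dunkl_hausdorff_integrand \<alpha> \<phi> f x)"
    and "dunkl_hausdorff \<alpha> \<phi> f \<in> borel_measurable lebesgue"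
    and "weighted_norm q v (dunkl_hausdorff \<alpha> \<phi> f) \<le> D_sup \<alpha> p q v w \<phi> * weighted_norm p w f"
proof -
  obtain v' where v' [measurable]: "v' \<in> borel_measurable lborel" and vv': "AE x in lborel. v x = v' x"
    using completion_ex_borel_measurable [of v lborel] v by (auto simp: weight_function_def)
  obtain w' where w' [measurable]: "w' \<in> borel_measurable lborel" and ww': "AE x in lborel. w x = w' x"
    using w completion_ex_borel_measurable [of w lborel] by (auto simp: weight_function_def)
  obtain \<phi>' where \<phi>' [measurable]: "\<phi>' \<in> borel_measurable lborel" and \<phi>\<phi>': "AE x in lborel. \<phi> x = \<phi>' x"
    using complex_Borel_representative [OF \<phi>] .
  have f_meas: "f \<in> borel_measurable lebesgue"
    using f by (simp add: weighted_Lebesgue_def)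
  obtain f' where f' [measurable]: "f' \<in> borel_measurable lborel" and ff': "AE x in lborel. f x = f' x"
    using complex_Borel_representative [OF f_meas] .
  have "AE x in lborel. 0 < w x \<and> w x < top"
    using w by (simp add: weight_function_def AE_completion_iff)
  with ww' have w'_pos: "AE x in lborel. 0 < w' x \<and> w' x < top"
    by eventually_elim simp
  have "AE x in lborel. 0 < v x \<and> v x < top"
    using v by (simp add: weight_function_def AE_completion_iff)
  with vv' have v'_pos: "AE x in lborel. 0 < v' x"
    by eventually_elim simp
  define \<kappa> where "\<kappa> t = norm (\<phi>' t) / \<bar>fst t * snd t\<bar> powr (2 * \<alpha> + 2)" for t
  note [measurable] = borel_measurable_coordinate_product
  have \<kappa> [measurable]: "\<kappa> \<in> borel_measurable lborel"
    unfolding \<kappa>_def by measurable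
  have \<kappa>_nonneg: "0 \<le> \<kappa> t" for t
    by (simp add: \<kappa>_def)
  define I where "I x t = complex_of_real (\<kappa> t) * f' (undilate x t)" for x t
  define G where "G x = (\<integral>\<^sup>+t. ennreal (norm (I x t)) \<partial>lborel)" for x
  have "(\<lambda>z. f' (undilate (fst z) (snd z))) \<in> borel_measurable (lborel \<Otimes>\<^sub>M lborel)"
    using f' by (intro measurable_compose [OF borel_measurable_plane_quotient]) simp
  then have I2: "(\<lambda>(x, t). I x t) \<in> borel_measurable (lborel \<Otimes>\<^sub>M lborel)"
    unfolding I_def case_prod_beta by measurable
  then have It [measurable]: "I x \<in> borel_measurable lborel" for x
    using measurable_Pair2 [OF I2, of x] by simp
  have G [measurable]: "G \<in> borel_measurable lborel"
    unfolding G_def using I2 by measurable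
  have AE_I: "AE x in lborel. AE t in lborel. dunkl_hausdorff_integrand \<alpha> \<phi> f x t = I x t"
    using AE_AE_quotient [OF ff']
  proof eventually_elim
    case (elim x)
    with \<phi>\<phi>' show ?case
      by eventually_elim (simp add: dunkl_hausdorff_integrand_def I_def \<kappa>_def case_prod_beta)
  qed

  have D_eq: "(\<integral>\<^sup>+t. ennreal (\<kappa> t) * (ennreal (\<bar>fst t * snd t\<bar> powr (1 / q)) * dilation_constant p q v' w' t) \<partial>lborel)
      = D_sup \<alpha> p q v w \<phi>"
    unfolding D_sup_eq
  proof (rule nn_integral_cong_AE)
    show "AE t in lborel. ennreal (\<kappa> t) * (ennreal (\<bar>fst t * snd t\<bar> powr (1 / q)) * dilation_constant p q v' w' t) =
      ennreal (norm (\<phi> t) / \<bar>fst t * snd t\<bar> powr (2 * \<alpha> + 2 - 1 / q)) * dilation_constant p q v w t"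
      using AE_lborel_coordinates_nonzero \<phi>\<phi>'
    proof eventually_elim
      case (elim t)
      then have "\<kappa> t * \<bar>fst t * snd t\<bar> powr (1 / q) =
          norm (\<phi> t) / \<bar>fst t * snd t\<bar> powr (2 * \<alpha> + 2 - 1 / q)"
        by (simp add: \<kappa>_def powr_diff)
      then have "ennreal (\<kappa> t) * ennreal (\<bar>fst t * snd t\<bar> powr (1 / q)) =
          ennreal (norm (\<phi> t) / \<bar>fst t * snd t\<bar> powr (2 * \<alpha> + 2 - 1 / q))"
        by (simp only: ennreal_mult' [OF \<kappa>_nonneg, symmetric])
      moreover have "dilation_constant p q v w t = dilation_constant p q v' w' t"
        using elim vv' ww' by (intro dilation_constant_cong_AE) auto
      ultimately show ?case
        by (simp add: mult.assoc [symmetric])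
    qed
  qed
  have f_eq: "ennreal_powr (\<integral>\<^sup>+y. ennreal_powr (ennreal (norm (f' y))) p * w' y \<partial>lborel) (1 / p) = weighted_norm p w f"
    unfolding weighted_norm_def nn_integral_completion
  proof (intro arg_cong2 [where f = ennreal_powr] nn_integral_cong_AE refl)
    show "AE y in lborel. ennreal_powr (ennreal (norm (f' y))) p * w' y = ennreal (norm (f y) powr p) * w y"
      using ff' ww' by eventually_elim (simp add: ennreal_powr_ennreal)
  qed
  have G_eq: "G x = (\<integral>\<^sup>+t. ennreal (\<kappa> t) * ennreal (norm (f' (undilate x t))) \<partial>lborel)" for x
    unfolding G_def I_def by (simp add: norm_mult \<kappa>_nonneg ennreal_mult')
  have G_le: "ennreal_powr (\<integral>\<^sup>+x. ennreal_powr (G x) q * v' x \<partial>lborel) (1 / q)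
      \<le> D_sup \<alpha> p q v w \<phi> * weighted_norm p w f"
    unfolding G_eq D_eq [symmetric] f_eq [symmetric]
    using pq w'_pos \<kappa> f' v' w' by (intro Hausdorff_norm_le) simp_all
  also have fin: "\<dots> < top"
    using D f by (simp add: weighted_Lebesgue_def ennreal_mult_less_top)
  finally have "(\<integral>\<^sup>+x. ennreal_powr (G x) q * v' x \<partial>lborel) \<noteq> \<infinity>"
    by simp
  then have "AE x in lborel. ennreal_powr (G x) q * v' x \<noteq> \<infinity>"
    by (intro nn_integral_PInf_AE) simp_all
  with v'_pos have G_fin: "AE x in lborel. G x < top"
    by eventually_elim (auto simp: ennreal_mult_eq_top_iff less_top)

  have AE_int: "AE x in lborel. integrable lebesgue (dunkl_hausdorff_integrand \<alpha> \<phi> f x) \<and>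
      dunkl_hausdorff \<alpha> \<phi> f x = (LINT t|lborel. I x t) \<and>
      ennreal (norm (dunkl_hausdorff \<alpha> \<phi> f x)) \<le> G x"
    using AE_I G_fin
  proof eventually_elim
    case (elim x)
    have eq: "AE t in lebesgue. I x t = dunkl_hausdorff_integrand \<alpha> \<phi> f x t"
      unfolding AE_completion_iff using elim(1) by eventually_elim simp
    have Il: "I x \<in> borel_measurable lebesgue"
      by (rule measurable_completion) simp
    have m: "dunkl_hausdorff_integrand \<alpha> \<phi> f x \<in> borel_measurable lebesgue"
      using borel_measurable_AE [OF Il eq] .
    have "integrable lborel (I x)"
      using elim(2) by (intro integrableI_bounded) (simp_all add: G_def)
    then have int: "integrable lebesgue (I x)"
      by (simp add: integrable_completion)
    have H: "dunkl_hausdorff \<alpha> \<phi> f x = (LINT t|lborel. I x t)"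
      unfolding dunkl_hausdorff_def
      using integral_cong_AE [OF Il m eq] by (simp add: integral_completion)
    show ?case
      using integrable_cong_AE [OF Il m eq] int H
        integral_norm_bound_ennreal [OF \<open>integrable lborel (I x)\<close>]
      by (simp add: G_def)
  qed
  then show "AE x in lebesgue. integrable lebesgue (dunkl_hausdorff_integrand \<alpha> \<phi> f x)"
    unfolding AE_completion_iff by eventually_elim simp
  have "(\<lambda>x. LINT t|lborel. I x t) \<in> borel_measurable lborel"
    using I2 by measurable
  then have "(\<lambda>x. LINT t|lborel. I x t) \<in> borel_measurable lebesgue"
    by (rule measurable_completion)
  moreover have "AE x in lebesgue. (LINT t|lborel. I x t) = dunkl_hausdorff \<alpha> \<phi> f x"
    unfolding AE_completion_iff using AE_int by eventually_elim simp
  ultimately show "dunkl_hausdorff \<alpha> \<phi> f \<in> borel_measurable lebesgue"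
    by (rule borel_measurable_AE)
  have "weighted_norm q v (dunkl_hausdorff \<alpha> \<phi> f) \<le> ennreal_powr (\<integral>\<^sup>+x. ennreal_powr (G x) q * v' x \<partial>lborel) (1 / q)"
    unfolding weighted_norm_def nn_integral_completion
  proof (intro ennreal_powr_mono nn_integral_mono_AE)
    show "AE x in lborel. ennreal (norm (dunkl_hausdorff \<alpha> \<phi> f x) powr q) * v x \<le> ennreal_powr (G x) q * v' x"
      using AE_int vv'
    proof eventually_elim
      case (elim x)
      from elim(1) have "ennreal (norm (dunkl_hausdorff \<alpha> \<phi> f x)) \<le> G x"
        by blast
      then have "ennreal_powr (ennreal (norm (dunkl_hausdorff \<alpha> \<phi> f x))) q \<le> ennreal_powr (G x) q"
        using pq by (intro ennreal_powr_mono) auto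
      then have "ennreal (norm (dunkl_hausdorff \<alpha> \<phi> f x) powr q) \<le> ennreal_powr (G x) q"
        by (simp only: ennreal_powr_ennreal norm_ge_zero)
      then show ?case
        unfolding elim(2) by (rule mult_right_mono) simp
    qed
  qed (use pq in simp)
  also note G_le
  finally show "weighted_norm q v (dunkl_hausdorff \<alpha> \<phi> f) \<le> D_sup \<alpha> p q v w \<phi> * weighted_norm p w f" .
qed

theorem theorem4p4:
  fixes p q \<alpha> :: real
    and v w :: "real \<times> real \<Rightarrow> ennreal"
    and \<phi> :: "real \<times> real \<Rightarrow> complex"
  assumes "1 < q" and "q < p"
    and "weight_function v" and "weight_function w"
    and "integrable lebesgue \<phi>"
    and "D_sup \<alpha> p q v w \<phi> < \<infinity>"
  shows "dunkl_hausdorff_bounded \<alpha> \<phi> p w q v \<and>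
    (\<forall>f \<in> weighted_Lebesgue p w.
       weighted_norm q v (dunkl_hausdorff \<alpha> \<phi> f) \<le> D_sup \<alpha> p q v w \<phi> * weighted_norm p w f)"
proof -
  note estimate = dunkl_hausdorff_estimate [OF assms(1-4) borel_measurable_integrable [OF assms(5)] assms(6)]
  have "dunkl_hausdorff \<alpha> \<phi> f \<in> weighted_Lebesgue q v" if f: "f \<in> weighted_Lebesgue p w" for f
  proof -
    have "D_sup \<alpha> p q v w \<phi> * weighted_norm p w f < \<infinity>"
      using assms(6) f by (simp add: weighted_Lebesgue_def ennreal_mult_less_top)
    then show ?thesis
      using estimate(2,3) [OF f] by (simp add: weighted_Lebesgue_def order_le_less_trans)
  qed
  then show ?thesis
    unfolding dunkl_hausdorff_bounded_def using estimate assms(6) by blast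
qed

end
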